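(* Let $d\ge2$, $T\in(0,+\infty)$, $\gamma\in\mathcal{C}_T=C([0,T];\mathbb{R}^d)$ and let $b\in L^1([0,T];C^0)$ satisfy $\nabla\cdot b\equiv0$ and $\nabla b\in L^1([0,T];L^{d,1})$. Let $X$ denote the Regular Lagrangian Flow associated to the ODE $x_t=x+\int_0^tb_s(x_s)\,\mathrm{d}s+\gamma_t$ on $[0,T]$. For every $x\in\mathbb{R}^d$ define recursively $Z^{(n)}(x)\in\mathcal{C}_T$ by $$Z^{(0)}_t(x)=x+\gamma_t,\qquad Z^{(n+1)}_t(x)=x+\int_0^tb_s(Z^{(n)}_s(x))\,\mathrm{d}s+\gamma_t .$$ Let $H_T(x):=\int_0^Th_s(X_s(x))\,\mathrm{d}s$, where $h$ is the asymmetric Lusin--Lipschitz weight of $b$ described in the context. Then $$\sup_{n\in\mathbb{N}}\,e^n\,\|Z^{(n)}(x)-X(x)\|_{\mathcal{C}_T}\le e^{e\,H_T(x)}\int_0^T\|b_t\|_{C^0}\,\mathrm{d}t\qquad\text{for a.e. }x\in\mathbb{R}^d.$$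
   Context: $C^0$ is the space of bounded continuous functions $\mathbb{R}^d\to\mathbb{R}^d$ with supremum norm; $\mathcal{C}_T$ carries the supremum norm. $\mathscr{L}^d$ is the Lebesgue measure on $\mathbb{R}^d$. $L^{p,q}$ are the Lorentz spaces on $\mathbb{R}^d$: $\|f\|_{L^{p,q}}^q=\int_0^\infty r^{q-1}\mathscr{L}^d(\{|f|>r\})^{q/p}\mathrm{d}r$ ($q<\infty$), $\|f\|_{L^{p,\infty}}=\sup_{r>0}r\,\mathscr{L}^d(\{|f|>r\})^{1/p}$. Weight $h$: a nonnegative measurable function $h\in L^1([0,T];L^{d,\infty})$ with $\|h_t\|_{L^{d,\infty}}\le C_d\|\nabla b_t\|_{L^{d,1}}$ and $|b_t(x)-b_t(y)|\le h_t(x)|x-y|$ for a.e. $t\in[0,T]$ and all $x,y\in\mathbb{R}^d$; such an $h$ exists whenever $b\in L^1([0,T];C^0)$ and $\nabla b\in L^1([0,T];L^{d,1})$. Consequently $H_T\in L^{d,\infty}$ with $\|H_T\|_{L^{d,\infty}}\lesssim\int_0^T\|\nabla b_s\|_{L^{d,1}}\mathrm{d}s$. Regular Lagrangian Flow: $X:[0,T]\times\mathbb{R}^d\to\mathbb{R}^d$ such that (i) for a.e. $x$, $\int_0^T|b_s(X_s(x))|\,\mathrm{d}s<\infty$ and $t\mapsto X_t(x)-\gamma_t$ is absolutely continuous, equals $x$ at $t=0$, and has derivative $b_t(X_t(x))$ for a.e. $t$; (ii) there is a constant $L$ with $\mathscr{L}^d(X_t^{-1}(A))\le L\,\mathscr{L}^d(A)$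 for all Borel $A$ and $t\in[0,T]$. For $d\ge2$, $\gamma\in C([0,T];\mathbb{R}^d)$ and $b\in L^1([0,T];C^0)$ with $\nabla\cdot b\equiv0$ and $\nabla b\in L^1([0,T];L^{d,1})$, the Regular Lagrangian Flow exists, is unique (up to null sets of $x$) and is measure-preserving. *)

theory Defs
  imports "HOL-Analysis.Analysis"
begin

section \<open>Powers and exponential on \<open>[0, \<infinity>]\<close>\<close>

text \<open>Only used for exponents \<open>a > 0\<close>, where \<open>\<infinity> powr a = \<infinity>\<close> and \<open>0 powr a = 0\<close>.\<close>

definition ennreal_powr :: "ennreal \<Rightarrow> real \<Rightarrow> ennreal" where
  "ennreal_powr x a = (if x = top then top else ennreal (enn2real x powr a))"

definition ennreal_exp :: "ennreal \<Rightarrow> ennreal" where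
  "ennreal_exp x = (if x = top then top else ennreal (exp (enn2real x)))"


section \<open>Lorentz norms\<close>

text \<open>The norms take \<open>F = |f|\<close> with values in \<open>[0, \<infinity>]\<close>, because the Lusin--Lipschitz weight
  may be infinite at some points.\<close>

definition lorentz_norm :: "real \<Rightarrow> real \<Rightarrow> ('a::euclidean_space \<Rightarrow> ennreal) \<Rightarrow> ennreal" where
  "lorentz_norm p q F =
     ennreal_powr
       (\<integral>\<^sup>+r\<in>{0<..}. ennreal (r powr (q - 1))
          * ennreal_powr (emeasure lebesgue {x. F x > ennreal r}) (q / p) \<partial>lborel)
       (1 / q)"

definition weak_lorentz_norm :: "real \<Rightarrow> ('a::euclidean_space \<Rightarrow> ennreal) \<Rightarrow> ennreal" where
  "weak_lorentz_norm p F =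
     (SUP r\<in>{0<..}. ennreal r * ennreal_powr (emeasure lebesgue {x. F x > ennreal r}) (1 / p))"


section \<open>Functions of time and space\<close>

text \<open>Membership in \<open>L\<^sup>1([0,T]; E)\<close> for a space \<open>E\<close> of functions of the space variable means joint
  Lebesgue measurability on \<open>[0,T] \<times> \<real>\<^sup>d\<close> together with integrability in time of the \<open>E\<close>-norm.\<close>

definition jointly_measurable ::
  "real \<Rightarrow> (real \<Rightarrow> 'a::euclidean_space \<Rightarrow> 'b::topological_space) \<Rightarrow> bool" where
  "jointly_measurable T f \<longleftrightarrow>
     (\<lambda>(t, x). f t x) \<in> borel_measurable (lebesgue_on ({0..T} \<times> UNIV))"

definition L1_C0 ::
  "real \<Rightarrow> (real \<Rightarrow> 'a::euclidean_space \<Rightarrow>\<^sub>C 'b::real_normed_vector) \<Rightarrow> bool" where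
  "L1_C0 T b \<longleftrightarrow> jointly_measurable T (\<lambda>t. apply_bcontfun (b t)) \<and>
     integrable (lebesgue_on {0..T}) (\<lambda>t. norm (b t))"

definition L1_lorentz ::
  "real \<Rightarrow> real \<Rightarrow> real \<Rightarrow> (real \<Rightarrow> 'a::euclidean_space \<Rightarrow> 'b::real_normed_vector) \<Rightarrow> bool" where
  "L1_lorentz T p q f \<longleftrightarrow> jointly_measurable T f \<and>
     (\<integral>\<^sup>+t\<in>{0..T}. lorentz_norm p q (\<lambda>x. ennreal (norm (f t x))) \<partial>lebesgue) < \<infinity>"

definition L1_weak_lorentz ::
  "real \<Rightarrow> real \<Rightarrow> (real \<Rightarrow> 'a::euclidean_space \<Rightarrow> ennreal) \<Rightarrow> bool" where
  "L1_weak_lorentz T p h \<longleftrightarrow> jointly_measurable T h \<and>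
     (\<integral>\<^sup>+t\<in>{0..T}. weak_lorentz_norm p (h t) \<partial>lebesgue) < \<infinity>"

definition CT_norm :: "real \<Rightarrow> (real \<Rightarrow> 'a::real_normed_vector) \<Rightarrow> ennreal" where
  "CT_norm T f = (SUP t\<in>{0..T}. ennreal (norm (f t)))"


section \<open>Distributional derivatives\<close>

definition partial_deriv :: "'n \<Rightarrow> (real^'n \<Rightarrow> real) \<Rightarrow> real^'n \<Rightarrow> real" where
  "partial_deriv j \<phi> x = frechet_derivative \<phi> (at x) (axis j 1)"

primrec Ck :: "nat \<Rightarrow> (real^'n \<Rightarrow> real) \<Rightarrow> bool" where
  "Ck 0 \<phi> \<longleftrightarrow> continuous_on UNIV \<phi>"
| "Ck (Suc k) \<phi> \<longleftrightarrow> (\<forall>x. \<phi> differentiable at x) \<and> (\<forall>j. Ck k (partial_deriv j \<phi>))"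

definition test_function :: "(real^'n \<Rightarrow> real) \<Rightarrow> bool" where
  "test_function \<phi> \<longleftrightarrow> (\<forall>k. Ck k \<phi>) \<and> compact (closure {x. \<phi> x \<noteq> 0})"

definition divergence_free :: "(real^'n \<Rightarrow> real^'n) \<Rightarrow> bool" where
  "divergence_free f \<longleftrightarrow>
     (\<forall>\<phi>. test_function \<phi> \<longrightarrow> (LINT x|lebesgue. (\<Sum>j\<in>UNIV. f x $ j * partial_deriv j \<phi> x)) = 0)"

text \<open>The entry \<open>g x $ i $ j\<close> is the \<open>j\<close>-th partial derivative of the \<open>i\<close>-th component; the norm on
  \<^typ>\<open>real^'n^'n\<close> is the Frobenius norm.\<close>

definition weak_gradient :: "(real^'n \<Rightarrow> real^'n) \<Rightarrow> (real^'n \<Rightarrow> real^'n^'n) \<Rightarrow> bool" where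
  "weak_gradient f g \<longleftrightarrow>
     (\<forall>K. compact K \<longrightarrow> set_integrable lebesgue K g) \<and>
     (\<forall>\<phi> i j. test_function \<phi> \<longrightarrow>
        (LINT x|lebesgue. f x $ i * partial_deriv j \<phi> x) = - (LINT x|lebesgue. g x $ i $ j * \<phi> x))"


section \<open>Regular Lagrangian flow\<close>

text \<open>A division consists of nonempty, non-overlapping closed intervals \<open>K = [Inf K, Sup K]\<close>.\<close>

definition abs_continuous_on :: "real \<Rightarrow> real \<Rightarrow> (real \<Rightarrow> 'a::real_normed_vector) \<Rightarrow> bool" where
  "abs_continuous_on u v f \<longleftrightarrow>
     (\<forall>\<epsilon>>0. \<exists>\<delta>>0. \<forall>\<D> S. \<D> division_of S \<and> S \<subseteq> {u..v} \<and> (\<Sum>K\<in>\<D>. Sup K - Inf K) < \<delta> \<longrightarrow>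
        (\<Sum>K\<in>\<D>. norm (f (Sup K) - f (Inf K))) < \<epsilon>)"

definition regular_lagrangian_flow ::
  "real \<Rightarrow> (real \<Rightarrow> (real^'n) \<Rightarrow>\<^sub>C (real^'n)) \<Rightarrow> (real \<Rightarrow> real^'n) \<Rightarrow> (real \<Rightarrow> real^'n \<Rightarrow> real^'n) \<Rightarrow> bool" where
  "regular_lagrangian_flow T b \<gamma> X \<longleftrightarrow>
     (AE x in lebesgue.
        integrable (lebesgue_on {0..T}) (\<lambda>s. norm (b s (X s x))) \<and>
        abs_continuous_on 0 T (\<lambda>t. X t x - \<gamma> t) \<and>
        X 0 x - \<gamma> 0 = x \<and>
        (AE t\<in>{0..T} in lebesgue.
           ((\<lambda>t. X t x - \<gamma> t) has_vector_derivative b t (X t x)) (at t within {0..T}))) \<and>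
     (\<forall>t\<in>{0..T}. X t \<in> borel_measurable lebesgue) \<and>
     (\<exists>L::real. \<forall>t\<in>{0..T}. \<forall>A\<in>sets borel.
        emeasure lebesgue (X t -` A) \<le> ennreal L * emeasure lebesgue A)"


section \<open>Asymmetric Lusin--Lipschitz weight and Picard iterates\<close>

text \<open>\<open>G\<close> is the spatial weak gradient of \<open>b\<close>. The Lipschitz bound is required at every \<open>x\<close>, so
  \<open>h\<close> has to be allowed the value \<open>\<infinity>\<close>, on a null set of \<open>x\<close> for a.e. \<open>t\<close>.\<close>

definition lusin_lipschitz_weight ::
  "real \<Rightarrow> real \<Rightarrow> (real \<Rightarrow> (real^'n) \<Rightarrow>\<^sub>C (real^'n)) \<Rightarrow> (real \<Rightarrow> real^'n \<Rightarrow> real^'n^'n)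
     \<Rightarrow> (real \<Rightarrow> real^'n \<Rightarrow> ennreal) \<Rightarrow> bool" where
  "lusin_lipschitz_weight T C b G h \<longleftrightarrow>
     L1_weak_lorentz T (real CARD('n)) h \<and>
     (AE t\<in>{0..T} in lebesgue.
        weak_lorentz_norm (real CARD('n)) (h t)
          \<le> ennreal C * lorentz_norm (real CARD('n)) 1 (\<lambda>x. ennreal (norm (G t x))) \<and>
        (\<forall>x y. ennreal (norm (b t x - b t y)) \<le> h t x * ennreal (norm (x - y))))"

definition weight_along_flow ::
  "real \<Rightarrow> (real \<Rightarrow> 'a \<Rightarrow> ennreal) \<Rightarrow> (real \<Rightarrow> 'a \<Rightarrow> 'a) \<Rightarrow> 'a \<Rightarrow> ennreal" where
  "weight_along_flow T h X x = (\<integral>\<^sup>+s\<in>{0..T}. h s (X s x) \<partial>lebesgue)"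

primrec picard ::
  "(real \<Rightarrow> (real^'n) \<Rightarrow>\<^sub>C (real^'n)) \<Rightarrow> (real \<Rightarrow> real^'n) \<Rightarrow> nat \<Rightarrow> real^'n \<Rightarrow> real \<Rightarrow> real^'n" where
  "picard b \<gamma> 0 x = (\<lambda>t. x + \<gamma> t)"
| "picard b \<gamma> (Suc n) x =
     (\<lambda>t. x + (LINT s|lebesgue_on {0..t}. b s (picard b \<gamma> n x s)) + \<gamma> t)"

end

theory Submission
  imports Defs
begin

text \<open>Fix \<open>x\<close>, put \<open>g s = h s (X s x)\<close>, \<open>H t = \<integral>\<^sub>0\<^sup>t g\<close> and \<open>M = \<integral>\<^sub>0\<^sup>T \<parallel>b s\<parallel>\<close>, and let \<open>D n t\<close> be the
  distance of the \<open>n\<close>-th iterate from \<open>X t x\<close>. Since the Lipschitz bound needs the weight at one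
  endpoint only, it can be taken on the flow, so \<open>D (n+1) t \<le> \<integral>\<^sub>0\<^sup>t g D n\<close> with \<open>D 0 \<le> M\<close>, and
  \<open>\<integral>\<^sub>0\<^sup>t g e\<^bsup>e H\<^esup> \<le> e\<^bsup>e H t\<^esup> / e\<close> gives \<open>D n t \<le> M e\<^bsup>- n\<^esup> e\<^bsup>e H t\<^esup>\<close> by induction. Nonsingularity of the
  flow is needed only to make \<open>g\<close> measurable for almost every \<open>x\<close>.\<close>


section \<open>Absolutely continuous functions\<close>

lemma abs_continuous_on_subinterval:
  assumes "abs_continuous_on a b f" "a \<le> c" "d \<le> b"
  shows "abs_continuous_on c d f"
proof -
  have "{c..d} \<subseteq> {a..b}"
    using assms by auto
  with assms(1) show ?thesis
    unfolding abs_continuous_on_def by (meson order_trans)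
qed

lemma abs_continuous_on_imp_continuous_on:
  assumes "abs_continuous_on a b f"
  shows "continuous_on {a..b} f"
  unfolding continuous_on_iff
proof safe
  fix x e :: real assume x: "x \<in> {a..b}" and "e > 0"
  with assms obtain \<delta> where "\<delta> > 0" and \<delta>: "\<And>\<D> S. \<lbrakk>\<D> division_of S; S \<subseteq> {a..b}; (\<Sum>K\<in>\<D>. Sup K - Inf K) < \<delta>\<rbrakk>
      \<Longrightarrow> (\<Sum>K\<in>\<D>. norm (f (Sup K) - f (Inf K))) < e"
    unfolding abs_continuous_on_def by meson
  have *: "dist (f u) (f v) < e" if "u \<le> v" "v - u < \<delta>" "u \<in> {a..b}" "v \<in> {a..b}" for u v
  proof -
    have "{cbox u v} division_of cbox u v"
      using that by (intro division_of_self) auto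
    from \<delta>[OF this] that show ?thesis
      by (simp add: dist_norm norm_minus_commute)
  qed
  show "\<exists>d>0. \<forall>x'\<in>{a..b}. dist x' x < d \<longrightarrow> dist (f x') (f x) < e"
  proof (intro exI conjI ballI impI)
    fix x' assume "x' \<in> {a..b}" "dist x' x < \<delta>"
    then show "dist (f x') (f x) < e"
      using *[of x x'] *[of x' x] x by (cases "x \<le> x'") (auto simp: dist_real_def dist_commute)
  qed fact
qed

text \<open>A gauge that keeps the intervals tagged in the exceptional null set inside an open set of small
  measure makes their contribution small by absolute continuity; the other intervals are treated
  as in the fundamental theorem of calculus.\<close>

lemma abs_continuous_on_has_integral:
  fixes f :: "real \<Rightarrow> 'a::banach"
  assumes "a \<le> b" and ac: "abs_continuous_on a b f"
    and der: "AE t\<in>{a..b} in lebesgue. (f has_vector_derivative f' t) (at t within {a..b})"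
  shows "(f' has_integral f b - f a) {a..b}"
proof -
  from der obtain N where N: "\<And>t. \<lbrakk>t \<notin> N; t \<in> {a..b}\<rbrakk> \<Longrightarrow> (f has_vector_derivative f' t) (at t within {a..b})"
      and N_null: "N \<in> null_sets lebesgue"
    by (rule AE_E3) auto
  from N_null have negN: "negligible N" and N_sets: "N \<in> sets lebesgue" and N0: "emeasure lebesgue N = 0"
    by (auto simp: negligible_iff_null_sets)
  \<comment> \<open>Setting the derivative to 0 on the null set removes it from every Riemann sum at
    tags in \<open>N\<close>, which then contribute increments of \<open>f\<close> only.
    \<open>has_integral_spike\<close> restores \<open>f'\<close> at the end.\<close>
  define g where "g t = (if t \<in> N then 0 else f' t)" for t
  have vecd: "(f has_vector_derivative g t) (at t within {a..b})" if "t \<in> {a..b}" "t \<notin> N" for t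
    using that N by (auto simp: g_def)
  have "(g has_integral f b - f a) {a..b}"
    unfolding has_integral_real
  proof (intro allI impI)
    fix e :: real assume "e > 0"
    \<comment> \<open>Half of \<open>e\<close> pays for the tags outside \<open>N\<close>: an error
      \<open>e1\<close> per unit length adds up to \<open>e1 * (b - a)\<close>. The
      \<open>+ 1\<close> keeps the denominator positive when \<open>a = b\<close>.\<close>
    define e1 where "e1 = e / (2 * (b - a + 1))"
    have "e1 > 0" and e1: "e1 * (b - a) < e / 2"
      using \<open>e > 0\<close> \<open>a \<le> b\<close> by (auto simp: e1_def field_simps)
    obtain \<delta> where "\<delta> > 0" and \<delta>: "\<And>\<D> S. \<lbrakk>\<D> division_of S; S \<subseteq> {a..b}; (\<Sum>K\<in>\<D>. Sup K - Inf K) < \<delta>\<rbrakk>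
        \<Longrightarrow> (\<Sum>K\<in>\<D>. norm (f (Sup K) - f (Inf K))) < e / 2"
      using ac \<open>e > 0\<close> unfolding abs_continuous_on_def by (meson half_gt_zero)
    obtain U where "open U" "N \<subseteq> U" and U: "U - N \<in> lmeasurable" "emeasure lebesgue (U - N) < ennreal \<delta>"
      using sets_lebesgue_outer_open[OF N_sets \<open>\<delta> > 0\<close>] .
    \<comment> \<open>The outer approximation controls \<open>U - N\<close> only; since
      \<open>N\<close> is null, \<open>U\<close> itself is just as small.\<close>
    have Um: "U \<in> lmeasurable" "measure lebesgue U < \<delta>"
    proof -
      have "emeasure lebesgue U = emeasure lebesgue (U - N)"
        using N_null \<open>open U\<close> by (simp add: emeasure_Diff_null_set)
      with U(2) have "emeasure lebesgue U < ennreal \<delta>" by simp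
      moreover from this show "U \<in> lmeasurable"
        using \<open>open U\<close> by (intro fmeasurableI) (auto intro: less_trans)
      ultimately show "measure lebesgue U < \<delta>"
        using \<open>\<delta> > 0\<close> by (simp add: emeasure_eq_measure2 ennreal_less_iff)
    qed
    \<comment> \<open>One radius serves both kinds of tags: off \<open>N\<close> it gives the
      first-order expansion with error \<open>e1\<close>, on \<open>N\<close> it keeps the ball
      inside \<open>U\<close>.\<close>
    have "\<exists>d>0. (\<forall>y. x \<in> {a..b} \<longrightarrow> x \<notin> N \<longrightarrow> y \<in> {a..b} \<longrightarrow> norm (y-x) < d \<longrightarrow>
           norm (f y - f x - (y-x) *\<^sub>R g x) \<le> e1 * norm (y-x)) \<and> (x \<in> N \<longrightarrow> ball x d \<subseteq> U)" for x
    proof (cases "x \<in> {a..b} \<and> x \<notin> N")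
      case True
      with vecd[of x] \<open>e1 > 0\<close> obtain d where "d > 0"
          "\<forall>y\<in>{a..b}. norm (y-x) < d \<longrightarrow> norm (f y - f x - (y-x) *\<^sub>R g x) \<le> e1 * norm (y-x)"
        unfolding has_vector_derivative_def has_derivative_within_alt by metis
      with True show ?thesis by auto
    next
      case False
      obtain d where "d > 0" "x \<in> N \<longrightarrow> ball x d \<subseteq> U"
        using \<open>open U\<close> \<open>N \<subseteq> U\<close> zero_less_one by (metis open_contains_ball subsetD)
      with False show ?thesis by auto
    qed
    then have "\<forall>x. \<exists>d>0. (\<forall>y. x \<in> {a..b} \<longrightarrow> x \<notin> N \<longrightarrow> y \<in> {a..b} \<longrightarrow> norm (y-x) < d \<longrightarrow>
           norm (f y - f x - (y-x) *\<^sub>R g x) \<le> e1 * norm (y-x)) \<and> (x \<in> N \<longrightarrow> ball x d \<subseteq> U)"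
      by blast
    from choice[OF this] obtain d where d: "\<And>x. 0 < d x"
        "\<And>x y. \<lbrakk>x \<in> {a..b}; x \<notin> N; y \<in> {a..b}; norm (y-x) < d x\<rbrakk>
                        \<Longrightarrow> norm (f y - f x - (y-x) *\<^sub>R g x) \<le> e1 * norm (y-x)"
        "\<And>x. x \<in> N \<Longrightarrow> ball x (d x) \<subseteq> U"
      by blast
    show "\<exists>\<gamma>. gauge \<gamma> \<and> (\<forall>p. p tagged_division_of {a..b} \<and> \<gamma> fine p \<longrightarrow>
        norm ((\<Sum>(x, k)\<in>p. measure lborel k *\<^sub>R g x) - (f b - f a)) < e)"
    proof (rule exI, safe)
      show "gauge (\<lambda>x. ball x (d x))"
        using d(1) gauge_ball_dependent by blast
    next
      fix p assume ptag: "p tagged_division_of {a..b}" and finep: "(\<lambda>x. ball x (d x)) fine p"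
      have ba: "b - a = (\<Sum>(x,K)\<in>p. Sup K - Inf K)" "f b - f a = (\<Sum>(x,K)\<in>p. f(Sup K) - f(Inf K))"
        using additive_tagged_division_1[where f= "\<lambda>x. x"] additive_tagged_division_1[where f= f]
              \<open>a \<le> b\<close> ptag by auto
      have "finite p" using ptag by blast
      define q where "q = {(x, K) \<in> p. x \<in> N}"
      have "q \<subseteq> p" by (auto simp: q_def)
      have ppart: "p tagged_partial_division_of {a..b}"
        using ptag by (simp add: tagged_division_of_def)
      have qtag: "q tagged_division_of \<Union> (snd ` q)"
        using tagged_partial_division_of_Union_self tagged_partial_division_subset[OF ppart \<open>q \<subseteq> p\<close>] by blast
      then have qdiv: "(snd ` q) division_of \<Union> (snd ` q)"
        by (rule division_of_tagged_division)
      have qsub: "\<Union> (snd ` q) \<subseteq> {a..b}"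
      proof safe
        fix x K y assume "(x, K) \<in> q" "y \<in> snd (x, K)"
        with \<open>q \<subseteq> p\<close> have "(x, K) \<in> p" "y \<in> K" by auto
        with tagged_division_ofD(3)[OF ptag] show "y \<in> {a..b}"
          by blast
      qed
      \<comment> \<open>The intervals tagged in \<open>N\<close> do not overlap and lie in
        \<open>U\<close>, so their total length is below \<delta> and absolute continuity applies to
        them as a division.\<close>
      have "(\<Sum>K\<in>snd ` q. Sup K - Inf K) = (\<Sum>K\<in>snd ` q. measure lebesgue K)"
      proof (rule sum.cong)
        fix K assume "K \<in> snd ` q"
        then obtain u v where "K = cbox u v" "K \<noteq> {}"
          using division_ofD(3,4)[OF qdiv] by metis
        then show "Sup K - Inf K = measure lebesgue K" by auto
      qed simp
      also have "\<dots> = measure lebesgue (\<Union> (snd ` q))"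
        using content_division[OF qdiv] by simp
      also have "\<dots> \<le> measure lebesgue U"
      proof (rule measure_mono_fmeasurable)
        show "\<Union> (snd ` q) \<subseteq> U"
        proof safe
          fix x K y assume "(x, K) \<in> q" "y \<in> snd (x, K)"
          then have "x \<in> N" "y \<in> K" "(x, K) \<in> p"
            by (auto simp: q_def)
          moreover from finep this(3) have "K \<subseteq> ball x (d x)"
            by blast
          ultimately have "x \<in> N" "y \<in> ball x (d x)"
            by auto
          then show "y \<in> U"
            using d(3) by blast
        qed
        show "\<Union> (snd ` q) \<in> sets lebesgue"
          using qdiv by (metis fmeasurableD lmeasurable_division)
      qed (rule Um)
      also have "\<dots> < \<delta>" by (rule Um)
      finally have "(\<Sum>K\<in>snd ` q. norm (f (Sup K) - f (Inf K))) < e / 2"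
        using \<delta> qdiv qsub by blast
      also have "(\<Sum>K\<in>snd ` q. norm (f (Sup K) - f (Inf K))) = (\<Sum>(x,K)\<in>q. norm (f (Sup K) - f (Inf K)))"
      proof -
        \<comment> \<open>Distinct tags can share an interval only if it has empty interior. There
          the increment is 0, and the convention \<open>?d {} = 0\<close> covers the empty set,
          where \<open>Sup\<close> and \<open>Inf\<close> carry no information.\<close>
        let ?d = "\<lambda>K. if K = {} then 0 else norm (f (Sup K) - f (Inf K))"
        have "(\<Sum>(x,K)\<in>q. ?d K) = (\<Sum>K\<in>snd ` q. ?d K)"
          by (rule sum.over_tagged_division_lemma[OF qtag]) (simp add: box_real)
        moreover have "(\<Sum>K\<in>snd ` q. ?d K) = (\<Sum>K\<in>snd ` q. norm (f (Sup K) - f (Inf K)))"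
          by (rule sum.cong) (use division_ofD(3)[OF qdiv] in auto)
        moreover have "(\<Sum>(x,K)\<in>q. ?d K) = (\<Sum>(x,K)\<in>q. norm (f (Sup K) - f (Inf K)))"
          by (rule sum.cong) (use division_ofD(3)[OF qdiv] in force)+
        ultimately show ?thesis by simp
      qed
      finally have q_le: "(\<Sum>(x,K)\<in>q. norm (f (Sup K) - f (Inf K))) < e / 2" .
      let ?r = "\<lambda>x K. measure lborel K *\<^sub>R g x - (f (Sup K) - f (Inf K))"
      have p_le: "norm (?r x K) \<le> e1 * (Sup K - Inf K)" if "(x, K) \<in> p - q" for x K
      proof -
        have "(x, K) \<in> p" "x \<notin> N"
          using that by (auto simp: q_def)
        then have "x \<in> K" and kab: "K \<subseteq> cbox a b"
          using ptag by auto
        then obtain u v where k: "K = cbox u v" and "x \<in> K" and kab: "K \<subseteq> cbox a b"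
          using ptag \<open>(x, K) \<in> p\<close> by blast
        have "u \<le> v"
          using \<open>x \<in> K\<close> unfolding k by auto
        have ball: "\<forall>y\<in>K. y \<in> ball x (d x)"
          using finep \<open>(x, K) \<in> p\<close> by blast
        have "u \<in> K" "v \<in> K"
          by (simp_all add: \<open>u \<le> v\<close> k)
        \<comment> \<open>Both endpoints are compared with the tag \<open>x\<close>; as
          \<open>x\<close> lies between them, the two distances add up to the length of
          \<open>K\<close>.\<close>
        have "norm ((v - u) *\<^sub>R g x - (f v - f u)) = norm (f u - f x - (u - x) *\<^sub>R g x - (f v - f x - (v - x) *\<^sub>R g x))"
          by (auto simp: algebra_simps)
        also have "\<dots> \<le> norm (f u - f x - (u - x) *\<^sub>R g x) + norm (f v - f x - (v - x) *\<^sub>R g x)"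
          by (rule norm_triangle_ineq4)
        also have "\<dots> \<le> e1 * norm (u - x) + e1 * norm (v - x)"
          using \<open>x \<in> K\<close> \<open>u \<in> K\<close> \<open>v \<in> K\<close> \<open>x \<notin> N\<close> kab ball
          by (intro add_mono d(2)) (auto simp: dist_real_def)
        also have "\<dots> \<le> e1 * (Sup K - Inf K)"
          using \<open>x \<in> K\<close> by (auto simp: k interval_bounds_real[OF \<open>u \<le> v\<close>] field_simps)
        finally show ?thesis
          using \<open>u \<le> v\<close> by (simp add: k)
      qed
      have "(\<Sum>(x, K)\<in>p. measure lborel K *\<^sub>R g x) - (f b - f a) = (\<Sum>(x,K)\<in>p. ?r x K)"
        by (simp add: ba(2) split_def sum_subtractf)
      also have "\<dots> = (\<Sum>(x,K)\<in>p - q. ?r x K) + (\<Sum>(x,K)\<in>q. ?r x K)"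
        by (rule sum.subset_diff[OF \<open>q \<subseteq> p\<close> \<open>finite p\<close>])
      also have "norm \<dots> \<le> (\<Sum>(x,K)\<in>p - q. e1 * (Sup K - Inf K)) + (\<Sum>(x,K)\<in>q. norm (f (Sup K) - f (Inf K)))"
      proof (intro norm_triangle_mono sum_norm_le; clarify)
        fix x K assume "(x, K) \<in> q"
        then have "g x = 0" by (simp add: q_def g_def)
        then show "norm (?r x K) \<le> norm (f (Sup K) - f (Inf K))"
          by (simp add: norm_minus_commute)
      qed (rule p_le, blast)
      also have "(\<Sum>(x,K)\<in>p - q. e1 * (Sup K - Inf K)) \<le> (\<Sum>(x,K)\<in>p. e1 * (Sup K - Inf K))"
      proof (rule sum_mono2[OF \<open>finite p\<close>])
        fix z assume "z \<in> p - (p - q)"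
        then obtain x K where "z = (x, K)" "(x, K) \<in> p" by (cases z) auto
        moreover then obtain u v where "K = cbox u v" "x \<in> K"
          using ptag by blast
        ultimately show "0 \<le> (case z of (x, K) \<Rightarrow> e1 * (Sup K - Inf K))"
          using \<open>e1 > 0\<close> by auto
      qed auto
      also have "\<dots> = e1 * (b - a)"
        by (simp add: ba(1) sum_distrib_left split_def)
      finally show "norm ((\<Sum>(x, k)\<in>p. measure lborel k *\<^sub>R g x) - (f b - f a)) < e"
        using e1 q_le by linarith
    qed
  qed
  then show ?thesis
    by (rule has_integral_spike[OF negN, rotated]) (auto simp: g_def)
qed


section \<open>Measurability along curves and flows\<close>

text \<open>The values \<open>\<phi> p r\<close> at the points \<open>r = \<lfloor>(n+1) \<tau> p\<rfloor> / (n+1)\<close> are measurable in \<open>p\<close>, since only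
  countably many \<open>r\<close> occur, and rounding down keeps \<open>r\<close> in \<open>[0, T]\<close>.\<close>

lemma measurable_caratheodory:
  fixes \<phi> :: "'m \<Rightarrow> real \<Rightarrow> 'b::metric_space"
  assumes meas: "\<And>r. r \<in> {0..T} \<Longrightarrow> (\<lambda>p. \<phi> p r) \<in> borel_measurable M"
    and \<tau>[measurable]: "\<tau> \<in> borel_measurable M"
    and range: "\<And>p. p \<in> space M \<Longrightarrow> \<tau> p \<in> {0..T}"
    and cont: "\<And>p. p \<in> space M \<Longrightarrow> continuous_on {0..T} (\<phi> p)"
  shows "(\<lambda>p. \<phi> p (\<tau> p)) \<in> borel_measurable M"
proof (rule borel_measurable_LIMSEQ_metric)
  define \<rho> where "\<rho> n r = min T (max 0 (real_of_int \<lfloor>real (Suc n) * r\<rfloor> / real (Suc n)))" for n r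
  show "(\<lambda>p. \<phi> p (\<rho> n (\<tau> p))) \<in> borel_measurable M" for n
  proof -
    \<comment> \<open>The clamp puts \<open>q k\<close> into \<open>{0..T}\<close> for every integer
      \<open>k\<close>, so \<open>meas\<close> covers all the countably many rounded values; a
      nonempty space supplies \<open>0 \<le> T\<close> for this.\<close>
    define q where "q k = min T (max 0 (real_of_int k / real (Suc n)))" for k :: int
    show ?thesis
    proof (cases "space M = {}")
      case True
      then show ?thesis by (simp add: measurable_def)
    next
      case False
      then have "0 \<le> T" using range by force
      then have "(\<lambda>p. \<phi> p (q k)) \<in> borel_measurable M" for k
        by (intro meas) (auto simp: q_def)
      then have "(\<lambda>p. \<phi> p (q \<lfloor>real (Suc n) * \<tau> p\<rfloor>)) \<in> borel_measurable M"
        by (rule measurable_compose_countable) measurable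
      then show ?thesis by (simp add: \<rho>_def q_def)
    qed
  qed
  fix p assume p: "p \<in> space M"
  let ?r = "\<tau> p"
  have r: "?r \<in> {0..T}" using range[OF p] .
  have "(\<lambda>n. real_of_int \<lfloor>real (Suc n) * ?r\<rfloor> / real (Suc n)) \<longlonglongrightarrow> ?r"
  proof (rule real_tendsto_sandwich)
    show "\<forall>\<^sub>F n in sequentially. ?r - 1 / real (Suc n) \<le> real_of_int \<lfloor>real (Suc n) * ?r\<rfloor> / real (Suc n)"
    proof (intro always_eventually allI)
      fix n
      have "(real (Suc n) * ?r - 1) / real (Suc n) \<le> real_of_int \<lfloor>real (Suc n) * ?r\<rfloor> / real (Suc n)"
        by (intro divide_right_mono) linarith+
      then show "?r - 1 / real (Suc n) \<le> real_of_int \<lfloor>real (Suc n) * ?r\<rfloor> / real (Suc n)"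
        by (simp add: diff_divide_distrib del: of_nat_Suc)
    qed
    show "\<forall>\<^sub>F n in sequentially. real_of_int \<lfloor>real (Suc n) * ?r\<rfloor> / real (Suc n) \<le> ?r"
    proof (intro always_eventually allI)
      fix n
      have "real_of_int \<lfloor>real (Suc n) * ?r\<rfloor> / real (Suc n) \<le> (real (Suc n) * ?r) / real (Suc n)"
        by (intro divide_right_mono) linarith+
      then show "real_of_int \<lfloor>real (Suc n) * ?r\<rfloor> / real (Suc n) \<le> ?r"
        by (simp del: of_nat_Suc)
    qed
    show "(\<lambda>n. ?r - 1 / real (Suc n)) \<longlonglongrightarrow> ?r"
      using tendsto_diff[OF tendsto_const LIMSEQ_inverse_real_of_nat, of ?r] by (simp add: inverse_eq_divide)
  qed simp
  then have "(\<lambda>n. \<rho> n ?r) \<longlonglongrightarrow> min T (max 0 ?r)"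
    unfolding \<rho>_def by (intro tendsto_intros)
  moreover have "min T (max 0 ?r) = ?r" using r by auto
  moreover have "\<rho> n ?r \<in> {0..T}" for n using r by (auto simp: \<rho>_def)
  ultimately show "(\<lambda>n. \<phi> p (\<rho> n ?r)) \<longlonglongrightarrow> \<phi> p ?r"
    using cont[OF p] r unfolding continuous_on_sequentially comp_def by auto
qed

text \<open>Borel measurability passes to sections and compositions, Lebesgue measurability in
  general does not. With a Borel version outside a Borel null set, both questions reduce to avoiding
  \<open>N\<close>.\<close>

lemma joint_lebesgue_measurable_version:
  fixes f :: "real \<times> 'a::euclidean_space \<Rightarrow> ennreal"
  assumes "f \<in> borel_measurable (lebesgue_on ({0..T} \<times> UNIV))"
  obtains f' N where "f' \<in> borel_measurable borel" "N \<in> null_sets lborel"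
    "\<And>t x. \<lbrakk>t \<in> {0..T}; (t, x) \<notin> N\<rbrakk> \<Longrightarrow> f (t, x) = f' (t, x)"
proof -
  have S: "{0..T} \<times> (UNIV::'a set) \<in> sets lebesgue"
    by (intro sets_completionI_sets) (simp add: borel_closed closed_Times)
  have "(\<lambda>z. f z * indicator ({0..T} \<times> UNIV) z) \<in> borel_measurable lebesgue"
    using assms S by (subst (asm) borel_measurable_restrict_space_iff_ennreal) auto
  from completion_ex_borel_measurable[OF this]
  obtain f' where "f' \<in> borel_measurable lborel" "AE z in lborel. f z * indicator ({0..T} \<times> UNIV) z = f' z"
    by blast
  moreover from this(2) obtain N where "\<And>z. z \<in> space lborel - N \<Longrightarrow> f z * indicator ({0..T} \<times> UNIV) z = f' z"
    "N \<in> null_sets lborel" by (rule AE_E3) auto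
  ultimately show ?thesis
    by (intro that[of f' N]) fastforce+
qed

text \<open>Tonelli for null sets, as Lebesgue measure on the product is the product measure. The
  second order of slicing comes from exchanging the almost-everywhere quantifiers, which uses that
  \<open>N\<close> is Borel.\<close>

lemma null_set_sections_lborel:
  fixes N :: "('b::euclidean_space \<times> 'a::euclidean_space) set"
  assumes "N \<in> null_sets lborel"
  shows "AE x in lborel. AE t in lborel. (t, x) \<notin> N"
    and "AE t in lborel. AE x in lborel. (t, x) \<notin> N"
proof -
  have N: "N \<in> null_sets (lborel \<Otimes>\<^sub>M lborel)"
    using assms by (simp add: lborel_prod)
  show *: "AE t in lborel. AE x in lborel. (t, x) \<notin> N"
    using lborel_pair.AE_pair[OF AE_not_in[OF N]] .
  have "{x \<in> space (lborel \<Otimes>\<^sub>M lborel). (fst x, snd x) \<notin> N} \<in> sets (lborel \<Otimes>\<^sub>M lborel)"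
    using sets.compl_sets[OF null_setsD2[OF N]] by (simp add: set_diff_eq)
  from lborel_pair.AE_commute[OF this] * show "AE x in lborel. AE t in lborel. (t, x) \<notin> N"
    by simp
qed

text \<open>The completion contains every subset of a null set, so the preimages under
  \<open>f\<close> and \<open>g\<close> differ by a measurable set.\<close>

lemma borel_measurable_completion_AE:
  assumes g: "g \<in> borel_measurable (completion M)" and eq: "AE x in M. f x = g x"
  shows "f \<in> borel_measurable (completion M)"
proof (rule measurableI)
  fix A :: "'b set" assume "A \<in> sets borel"
  then have g_sets: "g -` A \<inter> space M \<in> sets (completion M)"
    using measurable_sets[OF g] by simp
  show "f -` A \<inter> space (completion M) \<in> sets (completion M)"
  proof (rule completion.in_sets_AE[OF _ g_sets])
    show "AE x in completion M. (x \<in> g -` A \<inter> space M) = (x \<in> f -` A \<inter> space (completion M))"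
      using AE_completion[OF eq] by eventually_elim auto
  qed auto
qed simp

text \<open>Every section of the Borel version is Borel, and almost every section of the exceptional
  null set is null. Only almost every \<open>x\<close> can be expected, because \<open>f\<close> is
  arbitrary on that null set.\<close>

lemma AE_section_borel_measurable:
  fixes f :: "real \<times> 'a::euclidean_space \<Rightarrow> ennreal"
  assumes "f \<in> borel_measurable (lebesgue_on ({0..T} \<times> UNIV))"
  shows "AE x in lborel. (\<lambda>t. f (t, x)) \<in> borel_measurable (lebesgue_on {0..T})"
proof -
  obtain f' N where f'[measurable]: "f' \<in> borel_measurable borel" and N: "N \<in> null_sets lborel"
    and eq: "\<And>t x. \<lbrakk>t \<in> {0..T}; (t, x) \<notin> N\<rbrakk> \<Longrightarrow> f (t, x) = f' (t, x)"
    using joint_lebesgue_measurable_version[OF assms] by blast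
  from null_set_sections_lborel(1)[OF N] show ?thesis
  proof eventually_elim
    case (elim x)
    have "(\<lambda>t. f' (t, x) * indicator {0..T} t) \<in> borel_measurable lborel"
      by measurable
    then have "(\<lambda>t. f (t, x) * indicator {0..T} t) \<in> borel_measurable lebesgue"
    proof (rule borel_measurable_completion_AE[OF measurable_completion])
      show "AE t in lborel. f (t, x) * indicator {0..T} t = f' (t, x) * indicator {0..T} t"
        using elim by eventually_elim (use eq in \<open>auto simp: indicator_def\<close>)
    qed
    then show ?case
      by (simp add: borel_measurable_restrict_space_iff_ennreal)
  qed
qed

text \<open>Reduction to values in \<open>[0, \<infinity>]\<close> through the finitely many
  coordinates: \<open>ennreal\<close> truncates negative numbers to 0, so \<open>ennreal u\<close>
  and \<open>ennreal (- u)\<close> are the positive and negative parts of \<open>u\<close>.\<close>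

lemma AE_section_borel_measurable_euclidean:
  fixes f :: "real \<times> 'a::euclidean_space \<Rightarrow> 'b::euclidean_space"
  assumes f[measurable]: "f \<in> borel_measurable (lebesgue_on ({0..T} \<times> UNIV))"
  shows "AE x in lborel. (\<lambda>t. f (t, x)) \<in> borel_measurable (lebesgue_on {0..T})"
proof -
  have "AE x in lborel. (\<lambda>t. ennreal (f (t, x) \<bullet> i)) \<in> borel_measurable (lebesgue_on {0..T})" for i
    by (rule AE_section_borel_measurable[of "\<lambda>z. ennreal (f z \<bullet> i)"]) measurable
  moreover have "AE x in lborel. (\<lambda>t. ennreal (- (f (t, x) \<bullet> i))) \<in> borel_measurable (lebesgue_on {0..T})" for i
    by (rule AE_section_borel_measurable[of "\<lambda>z. ennreal (- (f z \<bullet> i))"]) measurable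
  ultimately have "AE x in lborel. \<forall>i\<in>Basis. (\<lambda>t. ennreal (f (t, x) \<bullet> i)) \<in> borel_measurable (lebesgue_on {0..T})
      \<and> (\<lambda>t. ennreal (- (f (t, x) \<bullet> i))) \<in> borel_measurable (lebesgue_on {0..T})"
    by (intro AE_finite_allI AE_conjI) auto
  then show ?thesis
  proof eventually_elim
    case (elim x)
    show ?case
    proof (subst borel_measurable_euclidean_space, safe)
      fix i :: 'b assume "i \<in> Basis"
      with elim have [measurable]: "(\<lambda>t. ennreal (f (t, x) \<bullet> i)) \<in> borel_measurable (lebesgue_on {0..T})"
          "(\<lambda>t. ennreal (- (f (t, x) \<bullet> i))) \<in> borel_measurable (lebesgue_on {0..T})"
        by auto
      have "(\<lambda>t. enn2real (ennreal (f (t, x) \<bullet> i)) - enn2real (ennreal (- (f (t, x) \<bullet> i))))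
          \<in> borel_measurable (lebesgue_on {0..T})"
        by measurable
      then show "(\<lambda>t. f (t, x) \<bullet> i) \<in> borel_measurable (lebesgue_on {0..T})"
      proof (rule measurable_cong[THEN iffD1, rotated])
        show "enn2real (ennreal (f (t, x) \<bullet> i)) - enn2real (ennreal (- (f (t, x) \<bullet> i))) = f (t, x) \<bullet> i" for t
          by (cases "0 \<le> f (t, x) \<bullet> i") (auto simp: ennreal_neg)
      qed
    qed
  qed
qed

text \<open>Joint measurability makes \<open>b s x\<close> measurable in \<open>s\<close> for almost
  every \<open>x\<close> only. These \<open>x\<close> are dense and \<open>b s\<close> is
  continuous, so limits reach every fixed \<open>x\<close>; approximating the moving point by fixed
  ones then reaches the curve.\<close>

lemma L1_C0_measurable_along_curve:
  fixes b :: "real \<Rightarrow> 'a::euclidean_space \<Rightarrow>\<^sub>C 'b::euclidean_space"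
  assumes b: "L1_C0 T b" and y: "continuous_on {0..T} y"
  shows "(\<lambda>s. b s (y s)) \<in> borel_measurable (lebesgue_on {0..T})"
proof -
  let ?Q = "{x. (\<lambda>s. b s x) \<in> borel_measurable (lebesgue_on {0..T})}"
  have "(\<lambda>(t, x). b t x) \<in> borel_measurable (lebesgue_on ({0..T} \<times> UNIV))"
    using b by (simp add: L1_C0_def jointly_measurable_def)
  from AE_section_borel_measurable_euclidean[OF this]
  have Q: "AE x in lborel. x \<in> ?Q" by simp
  have const_curve: "(\<lambda>s. b s x) \<in> borel_measurable (lebesgue_on {0..T})" for x
  proof -
    have "\<exists>q. q \<in> ?Q \<and> dist q x < inverse (real (Suc n))" for n
    proof (rule ccontr)
      assume no_q: "\<nexists>q. q \<in> ?Q \<and> dist q x < inverse (real (Suc n))"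
      from Q obtain N where N: "\<And>q. q \<in> space lborel - N \<Longrightarrow> q \<in> ?Q" "N \<in> null_sets lborel"
        by (rule AE_E3) blast
      then have "negligible N"
        by (simp add: negligible_iff_null_sets null_sets_completionI)
      moreover have "ball x (inverse (real (Suc n))) \<subseteq> N"
      proof
        fix q assume "q \<in> ball x (inverse (real (Suc n)))"
        then have "dist q x < inverse (real (Suc n))" by (simp add: dist_commute)
        with no_q have "q \<notin> ?Q" by blast
        with N(1)[of q] show "q \<in> N" by auto
      qed
      ultimately have "negligible (ball x (inverse (real (Suc n))))"
        by (rule negligible_subset)
      then show False
        by (simp add: open_not_negligible del: of_nat_Suc)
    qed
    then obtain q where q: "\<And>n. q n \<in> ?Q" "\<And>n. dist (q n) x < inverse (real (Suc n))"
      by metis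
    have "(\<lambda>n. dist (q n) x) \<longlonglongrightarrow> 0"
    proof (rule tendsto_sandwich[OF _ _ tendsto_const LIMSEQ_inverse_real_of_nat])
      show "\<forall>\<^sub>F n in sequentially. dist (q n) x \<le> inverse (real (Suc n))"
        using q(2) by (intro always_eventually allI less_imp_le)
    qed simp
    then have "q \<longlonglongrightarrow> x"
      by (rule tendsto_dist_iff[THEN iffD2])
    then have "(\<lambda>n. b s (q n)) \<longlonglongrightarrow> b s x" for s
      by (rule continuous_on_tendsto_compose[OF continuous_on_apply_bcontfun[of UNIV]]) auto
    then show ?thesis
      by (rule borel_measurable_LIMSEQ_metric[rotated]) (use q(1) in auto)
  qed
  show ?thesis
  \<comment> \<open>Time enters twice: as the parameter \<open>s\<close>, where
    \<open>const_curve\<close> applies with the point \<open>y r\<close> frozen, and as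
    \<open>r\<close>, in which \<open>b s (y r)\<close> is continuous.\<close>
  proof (rule measurable_caratheodory[where \<phi>="\<lambda>s r. b s (y r)" and \<tau>="\<lambda>s. s"])
    show "(\<lambda>s. s) \<in> borel_measurable (lebesgue_on {0..T})"
      by (intro measurable_restrict_space1 measurable_completion) simp
    show "continuous_on {0..T} (\<lambda>r. b s (y r))" for s
      by (rule continuous_on_compose2[OF continuous_on_apply_bcontfun[of UNIV] y]) auto
  qed (auto intro: const_curve)
qed

lemma continuous_on_clamp:
  fixes g :: "real \<Rightarrow> 'b::topological_space"
  assumes "0 \<le> T" "continuous_on {0..T} g"
  shows "continuous_on UNIV (\<lambda>t. g (min T (max 0 t)))"
  using assms by (intro continuous_on_compose2[OF assms(2)] continuous_intros) auto

lemma sigma_finite_completion: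
  assumes "sigma_finite_measure M"
  shows "sigma_finite_measure (completion M)"
proof -
  from sigma_finite_measure.sigma_finite_countable[OF assms] obtain A
    where A: "countable A" "A \<subseteq> sets M" "\<Union>A = space M" "\<forall>a\<in>A. emeasure M a \<noteq> \<infinity>"
    by blast
  show ?thesis
  proof (standard, intro exI[of _ A] conjI ballI)
    show "emeasure (completion M) a \<noteq> \<infinity>" if "a \<in> A" for a
      using A that by (auto simp: emeasure_completion)
  qed (use A in auto)
qed

text \<open>By nonsingularity, for almost every \<open>t\<close> the point \<open>(t, X t x)\<close>
  avoids the null set \<open>N\<close> for almost every \<open>x\<close>. Fubini exchanges the
  quantifiers, so along almost every trajectory \<open>f\<close> agrees with its Borel version at
  almost every time.\<close>

lemma AE_measurable_along_flow:
  fixes f :: "real \<times> 'a::euclidean_space \<Rightarrow> ennreal" and X :: "real \<Rightarrow> 'a \<Rightarrow> 'a"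
  assumes "0 \<le> T"
    and f: "f \<in> borel_measurable (lebesgue_on ({0..T} \<times> UNIV))"
    and X: "\<And>t. t \<in> {0..T} \<Longrightarrow> X t \<in> borel_measurable lebesgue"
    and cont: "AE x in lebesgue. continuous_on {0..T} (\<lambda>t. X t x)"
    and nonsingular: "\<And>t A. \<lbrakk>t \<in> {0..T}; A \<in> null_sets lborel\<rbrakk> \<Longrightarrow> X t -` A \<in> null_sets lebesgue"
  shows "AE x in lebesgue. (\<lambda>s. f (s, X s x)) \<in> borel_measurable (lebesgue_on {0..T})"
proof -
  obtain f' N where f'[measurable]: "f' \<in> borel_measurable borel" and N: "N \<in> null_sets lborel"
    and eq: "\<And>t x. \<lbrakk>t \<in> {0..T}; (t, x) \<notin> N\<rbrakk> \<Longrightarrow> f (t, x) = f' (t, x)"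
    using joint_lebesgue_measurable_version[OF f] by blast
  have [measurable]: "N \<in> sets (borel \<Otimes>\<^sub>M borel)"
    using null_setsD2[OF N] unfolding borel_prod by simp
  from cont obtain Z where Z: "\<And>x. x \<notin> Z \<Longrightarrow> continuous_on {0..T} (\<lambda>t. X t x)" "Z \<in> null_sets lebesgue"
    by (rule AE_E3) auto
  have [measurable]: "Z \<in> sets lebesgue" using Z(2) by auto
  have notZ: "AE x in lebesgue. x \<notin> Z" using Z(2) by (rule AE_not_in)
  \<comment> \<open>Clamped times let the exchange take place on the whole real line although
    \<open>X\<close> is controlled on \<open>{0..T}\<close> only.\<close>
  define clamp where "clamp t = min T (max 0 t)" for t :: real
  have clamp: "clamp t \<in> {0..T}" "t \<in> {0..T} \<Longrightarrow> clamp t = t" for t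
    using \<open>0 \<le> T\<close> by (auto simp: clamp_def)
  have [measurable]: "clamp \<in> borel_measurable borel"
    unfolding clamp_def by measurable
  \<comment> \<open>Trajectories that may be discontinuous are replaced by 0, since the Caratheodory
    argument asks for continuity at every \<open>x\<close>; this affects a null set of starting
    points.\<close>
  define Y where "Y t x = (if x \<in> Z then 0 else X t x)" for t x
  have Y_cont: "continuous_on {0..T} (\<lambda>t. Y t x)" for x
    using Z(1) by (cases "x \<in> Z") (auto simp: Y_def)
  have Y_meas: "Y t \<in> borel_measurable lebesgue" if "t \<in> {0..T}" for t
  proof -
    note X[OF that, measurable]
    show ?thesis unfolding Y_def by measurable
  qed
  \<comment> \<open>The exchange of quantifiers requires joint measurability. The space factor
    carries the completed measure because each \<open>X t\<close> is only Lebesgue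
    measurable.\<close>
  have [measurable]: "(\<lambda>p. Y (clamp (fst p)) (snd p)) \<in> borel_measurable (lborel \<Otimes>\<^sub>M lebesgue)"
  proof (rule measurable_caratheodory[where \<phi>="\<lambda>p r. Y r (snd p)" and \<tau>="\<lambda>p. clamp (fst p)"])
    show "(\<lambda>p. Y r (snd p)) \<in> borel_measurable (lborel \<Otimes>\<^sub>M lebesgue)" if "r \<in> {0..T}" for r
      using Y_meas[OF that] by measurable
  qed (use clamp Y_cont in auto)
  have "AE t in lborel. AE x in lebesgue. (t, Y (clamp t) x) \<notin> N \<or> t \<notin> {0..T}"
    using null_set_sections_lborel(2)[OF N]
  proof eventually_elim
    case (elim t)
    have "{x. (t, x) \<in> N} \<in> sets lborel"
      using sets_Pair1[of N borel borel t] by (simp add: vimage_def)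
    with elim have "{x. (t, x) \<in> N} \<in> null_sets lborel"
      by (simp add: AE_iff_null_sets)
    note null = this
    have avoid: "AE x in lebesgue. (t, X t x) \<notin> N" if "t \<in> {0..T}"
      using AE_not_in[OF nonsingular[OF that null]] by simp
    show ?case
    proof (cases "t \<in> {0..T}")
      case True
      from avoid[OF True] notZ show ?thesis
      proof eventually_elim
        case (elim x)
        then show ?case
          by (simp add: clamp(2)[OF True] Y_def)
      qed
    qed simp
  qed
  then have "AE x in lebesgue. AE t in lborel. (t, Y (clamp t) x) \<notin> N \<or> t \<notin> {0..T}"
  proof (subst (asm) pair_sigma_finite.AE_commute)
    show "pair_sigma_finite lborel (lebesgue :: 'a measure)"
      by (intro pair_sigma_finite.intro sigma_finite_completion sigma_finite_lborel)
    show "{p \<in> space (lborel \<Otimes>\<^sub>M lebesgue). (fst p, Y (clamp (fst p)) (snd p)) \<notin> N \<or> fst p \<notin> {0..T}}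
        \<in> sets (lborel \<Otimes>\<^sub>M lebesgue)"
      by measurable
  qed
  with notZ show ?thesis
  proof eventually_elim
    case (elim x)
    have [measurable]: "(\<lambda>t. X (clamp t) x) \<in> borel_measurable borel"
      unfolding clamp_def
      by (intro borel_measurable_continuous_onI continuous_on_clamp[where g="\<lambda>t. X t x"] Z elim \<open>0 \<le> T\<close>)
    have "(\<lambda>t. f' (t, X (clamp t) x) * indicator {0..T} t) \<in> borel_measurable lborel"
      by measurable
    then have "(\<lambda>t. f (t, X t x) * indicator {0..T} t) \<in> borel_measurable lebesgue"
    proof (rule borel_measurable_completion_AE[OF measurable_completion])
      show "AE t in lborel. f (t, X t x) * indicator {0..T} t = f' (t, X (clamp t) x) * indicator {0..T} t"
        using elim(2)
      proof eventually_elim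
        case (elim t)
        then show ?case
          using \<open>x \<notin> Z\<close> eq[of t "X t x"] by (cases "t \<in> {0..T}") (auto simp: clamp Y_def)
      qed
    qed
    then show ?case
      by (simp add: borel_measurable_restrict_space_iff_ennreal)
  qed
qed


section \<open>Convergence of the Picard iterates\<close>

text \<open>No chain rule for \<open>H\<close> is needed: \<open>H\<close> pushes the measure \<open>g ds\<close> on \<open>[0, t]\<close> forward to
  Lebesgue measure on \<open>[0, H t]\<close>.\<close>

lemma nn_integral_exp_primitive:
  fixes g :: "real \<Rightarrow> real"
  assumes g: "integrable (lebesgue_on {0..T}) g" and nonneg: "\<And>s. 0 \<le> g s"
    and t: "t \<in> {0..T}" and "c > 0"
  defines "H \<equiv> \<lambda>t. LINT s|lebesgue_on {0..t}. g s"
  shows "(\<integral>\<^sup>+s. ennreal (g s) * ennreal (exp (c * H s)) \<partial>lebesgue_on {0..t}) = ennreal ((exp (c * H t) - 1) / c)"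
proof -
  let ?L = "lebesgue_on {0..t}"
  let ?M = "density ?L (\<lambda>s. ennreal (g s))"
  have sub: "integrable (lebesgue_on {0..v}) g" if "v \<in> {0..T}" for v
    using that by (intro integrable_subinterval[OF g]) auto
  have H_cont: "continuous_on {0..t} H"
    unfolding H_def using indefinite_integral_continuous_real[OF sub[OF t]] .
  have [measurable]: "g \<in> borel_measurable ?L"
    using sub[OF t] by auto
  have [measurable]: "H \<in> borel_measurable ?L"
    using H_cont by (intro continuous_imp_measurable_on_sets_lebesgue) auto
  have em: "emeasure ?M {0..v} = ennreal (H v)" if "v \<in> {0..t}" for v
  proof -
    have "emeasure ?M {0..v} = (\<integral>\<^sup>+s. ennreal (g s) * indicator {0..v} s \<partial>?L)"
      using that by (subst emeasure_density) (auto simp: sets_restrict_space_iff)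
    also have "\<dots> = (\<integral>\<^sup>+s. ennreal (g s) \<partial>lebesgue_on {0..v})"
      using that by (auto simp: nn_integral_restrict_space indicator_def intro!: nn_integral_cong)
    also have "\<dots> = ennreal (H v)"
      unfolding H_def using that t by (intro nn_integral_eq_integral sub) (auto simp: nonneg)
    finally show ?thesis .
  qed
  have H_nonneg: "0 \<le> H v" for v
    unfolding H_def by (simp add: nonneg)
  have H_mono: "H u \<le> H v" if "0 \<le> u" "u \<le> v" "v \<le> t" for u v
  proof -
    have "emeasure ?M {0..u} \<le> emeasure ?M {0..v}"
      using that by (intro emeasure_mono) (auto simp: sets_restrict_space_iff)
    with that show ?thesis
      by (simp add: em ennreal_le_iff H_nonneg)
  qed
  have H0: "H 0 = 0"
    using lebesgue_integral_eq_integral[OF sub[of 0]] t by (simp add: H_def)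
  \<comment> \<open>Measures with finite mass on all half-lines \<open>{r<..}\<close> coincide if
    these masses agree; here both equal \<open>H t - max 0 r\<close>, truncated at 0.\<close>
  have "distr ?M borel H = density lborel (indicator {0..H t})"
  proof (rule measure_eqI_lessThan)
    have super_level: "emeasure (distr ?M borel H) {r<..} = ennreal (H t - max 0 r)" for r
    proof -
      have "emeasure (distr ?M borel H) {r<..} = emeasure ?M {s \<in> {0..t}. r < H s}"
        by (subst emeasure_distr) (auto simp: vimage_def intro!: arg_cong[where f="emeasure _"])
      also have "\<dots> = ennreal (H t - max 0 r)"
      proof -
        consider "r < 0" | "H t \<le> r" "0 \<le> r" | "0 \<le> r" "r < H t" by linarith
        then show ?thesis
        proof cases
          case 1
          then have "{s \<in> {0..t}. r < H s} = {0..t}"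
            using H_nonneg less_le_trans by blast
          with 1 show ?thesis
            using t by (simp add: em)
        next
          case 2
          have "\<not> r < H s" if "s \<in> {0..t}" for s
            using H_mono[of s t] that 2 by auto
          then have "{s \<in> {0..t}. r < H s} = {}" by blast
          then show ?thesis
            using 2 by (simp only: emeasure_empty) (simp add: ennreal_neg)
        next
          case 3
          \<comment> \<open>Since \<open>H\<close> is monotone, \<open>{r < H}\<close> is the
            interval after the last time \<open>s\<close> at which \<open>H \<le> r\<close>. The
            intermediate value theorem gives \<open>H s = r\<close>, so its mass is
            \<open>H t - r\<close>, even if \<open>H\<close> has plateaus.\<close>
          let ?S = "{s \<in> {0..t}. H s \<le> r}"
          have "closed ?S"
            using continuous_closed_preimage[OF H_cont closed_atLeastAtMost closed_atMost[of r]]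
            by (simp add: vimage_def Int_def)
          moreover have bdd: "bdd_above ?S" by (rule bdd_aboveI[of _ t]) auto
          moreover have "0 \<in> ?S" using 3 t H0 by auto
          ultimately have sS: "Sup ?S \<in> ?S"
            by (intro closed_contains_Sup) auto
          have "\<exists>s\<ge>Sup ?S. s \<le> t \<and> H s = r"
            using sS 3 by (intro IVT' continuous_on_subset[OF H_cont]) auto
          then obtain s where s: "s \<ge> Sup ?S" "s \<le> t" "H s = r" by blast
          then have "s \<in> ?S" using sS by auto
          then have "s = Sup ?S" using s(1) cSup_upper[OF _ bdd] by force
          have "0 \<le> s" using \<open>s \<in> ?S\<close> by auto
          have "{s \<in> {0..t}. r < H s} = {0..t} - {0..s}"
          proof -
            have "H u \<le> r \<longleftrightarrow> u \<le> s" if "u \<in> {0..t}" for u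
              using that s H_mono[of u s] cSup_upper[OF _ bdd, of u] \<open>s = Sup ?S\<close> by auto
            then show ?thesis by force
          qed
          moreover have "emeasure ?M ({0..t} - {0..s}) = emeasure ?M {0..t} - emeasure ?M {0..s}"
            using s \<open>0 \<le> s\<close> by (intro emeasure_Diff) (auto simp: em sets_restrict_space_iff)
          ultimately show ?thesis
            using s \<open>0 \<le> s\<close> 3 t by (simp add: em ennreal_minus)
        qed
      qed
      finally show ?thesis .
    qed
    show "emeasure (distr ?M borel H) {r<..} < \<infinity>" for r
      by (simp add: super_level)
    fix r
    have "emeasure (density lborel (indicator {0..H t})) {r<..} = emeasure lborel ({0..H t} \<inter> {r<..})"
      by (subst emeasure_density) (auto simp: indicator_inter_arith[symmetric])
    also have "\<dots> = ennreal (H t - max 0 r)"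
    proof (cases "r < 0")
      case True
      then have "{0..H t} \<inter> {r<..} = {0..H t}" by auto
      with True H_nonneg show ?thesis by simp
    next
      case False
      then have "{0..H t} \<inter> {r<..} = {r<..H t}" by auto
      with False show ?thesis
        by (cases "r \<le> H t") (auto simp: ennreal_neg)
    qed
    finally show "emeasure (distr ?M borel H) {r<..} = emeasure (density lborel (indicator {0..H t})) {r<..}"
      by (simp add: super_level)
  qed auto
  note pushforward = this
  have "(\<integral>\<^sup>+s. ennreal (g s) * ennreal (exp (c * H s)) \<partial>?L) = (\<integral>\<^sup>+s. ennreal (exp (c * H s)) \<partial>?M)"
    by (subst nn_integral_density) auto
  also have "\<dots> = (\<integral>\<^sup>+r. ennreal (exp (c * r)) \<partial>distr ?M borel H)"
    by (subst nn_integral_distr) auto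
  also have "\<dots> = (\<integral>\<^sup>+r. ennreal (exp (c * r)) * indicator {0..H t} r \<partial>lborel)"
    unfolding pushforward by (subst nn_integral_density) (auto simp: mult.commute)
  also have "\<dots> = ennreal (exp (c * H t) / c - exp (c * 0) / c)"
    using H_nonneg \<open>c > 0\<close>
    by (intro nn_integral_FTC_Icc) (auto intro!: derivative_eq_intros simp: field_simps)
  finally show ?thesis
    by (simp add: diff_divide_distrib)
qed

text \<open>The sup norm dominates \<open>b\<close> along any curve, so the last bound is uniform in
  \<open>y\<close> and \<open>t\<close>. It starts the induction for the Picard error.\<close>

lemma L1_C0_integral_along_curve:
  fixes b :: "real \<Rightarrow> 'a::euclidean_space \<Rightarrow>\<^sub>C 'b::euclidean_space"
  assumes b: "L1_C0 T b" and y: "continuous_on {0..T} y"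
  shows "integrable (lebesgue_on {0..T}) (\<lambda>s. b s (y s))"
    and "t \<in> {0..T} \<Longrightarrow> integrable (lebesgue_on {0..t}) (\<lambda>s. b s (y s))"
    and "t \<in> {0..T} \<Longrightarrow> norm (LINT s|lebesgue_on {0..t}. b s (y s)) \<le> (LINT s|lebesgue_on {0..T}. norm (b s))"
proof -
  have b_int: "integrable (lebesgue_on {0..T}) (\<lambda>s. norm (b s))"
    using b by (simp add: L1_C0_def)
  show int: "integrable (lebesgue_on {0..T}) (\<lambda>s. b s (y s))"
    by (rule Bochner_Integration.integrable_bound[OF b_int L1_C0_measurable_along_curve[OF b y]])
      (simp add: norm_bounded)
  assume t: "t \<in> {0..T}"
  show int_t: "integrable (lebesgue_on {0..t}) (\<lambda>s. b s (y s))"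
    using t by (intro integrable_subinterval[OF int]) auto
  have b_int_t: "integrable (lebesgue_on {0..t}) (\<lambda>s. norm (b s))"
    using t by (intro integrable_subinterval[OF b_int]) auto
  have "norm (LINT s|lebesgue_on {0..t}. b s (y s)) \<le> (LINT s|lebesgue_on {0..t}. norm (b s (y s)))"
    by (rule integral_norm_bound)
  also have "\<dots> \<le> (LINT s|lebesgue_on {0..t}. norm (b s))"
    using int_t b_int_t by (intro integral_mono) (auto simp: norm_bounded)
  also have "\<dots> = integral {0..t} (\<lambda>s. norm (b s))"
    using b_int_t by (intro lebesgue_integral_eq_integral) auto
  also have "\<dots> \<le> integral {0..T} (\<lambda>s. norm (b s))"
    using t b_int b_int_t by (intro integral_subset_le integrable_on_lebesgue_on) auto
  also have "\<dots> = (LINT s|lebesgue_on {0..T}. norm (b s))"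
    using b_int by (intro lebesgue_integral_eq_integral[symmetric]) auto
  finally show "norm (LINT s|lebesgue_on {0..t}. b s (y s)) \<le> (LINT s|lebesgue_on {0..T}. norm (b s))" .
qed

text \<open>A continuous iterate makes \<open>b\<close> integrable along it, and the primitive of an
  integrable function is continuous.\<close>

lemma continuous_on_picard:
  assumes b: "L1_C0 T b" and \<gamma>: "continuous_on {0..T} \<gamma>"
  shows "continuous_on {0..T} (picard b \<gamma> n x)"
proof (induction n)
  case 0
  show ?case by (auto intro!: continuous_intros \<gamma>)
next
  case (Suc n)
  have "continuous_on {0..T} (\<lambda>t. LINT s|lebesgue_on {0..t}. b s (picard b \<gamma> n x s))"
    by (intro indefinite_integral_continuous_real L1_C0_integral_along_curve b Suc)
  then show ?case
    by (auto intro!: continuous_intros \<gamma>)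
qed

text \<open>Pathwise estimate for a finite weight. Integrating \<open>g * exp (c * H)\<close> gains
  a factor \<open>1 / c\<close>, and the choice \<open>c = exp 1\<close> turns it into the step from
  \<open>exp (- real n)\<close> to \<open>exp (- real (Suc n))\<close>.\<close>

lemma picard_error_bound:
  fixes b :: "real \<Rightarrow> (real^'n) \<Rightarrow>\<^sub>C (real^'n)"
  assumes b: "L1_C0 T b" and \<gamma>: "continuous_on {0..T} \<gamma>"
    and y: "continuous_on {0..T} y"
    and y_eq: "\<And>t. t \<in> {0..T} \<Longrightarrow> y t = x + (LINT s|lebesgue_on {0..t}. b s (y s)) + \<gamma> t"
    and g: "integrable (lebesgue_on {0..T}) g" and nonneg: "\<And>s. 0 \<le> g s"
    and lip: "AE s in lebesgue_on {0..T}. \<forall>z. norm (b s z - b s (y s)) \<le> g s * norm (z - y s)"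
    and t: "t \<in> {0..T}"
  shows "norm (picard b \<gamma> n x t - y t)
    \<le> (LINT s|lebesgue_on {0..T}. norm (b s)) * exp (- real n) * exp (exp 1 * (LINT s|lebesgue_on {0..t}. g s))"
  using t
proof (induction n arbitrary: t)
  case (0 t)
  \<comment> \<open>\<open>x\<close> and \<gamma> cancel, leaving the drift collected along
    \<open>y\<close>.\<close>
  have "norm (picard b \<gamma> 0 x t - y t) = norm (LINT s|lebesgue_on {0..t}. b s (y s))"
    using y_eq[OF 0] by (simp add: norm_minus_commute)
  also have "\<dots> \<le> (LINT s|lebesgue_on {0..T}. norm (b s)) * 1"
    using L1_C0_integral_along_curve(3)[OF b y 0] by simp
  also have "\<dots> \<le> (LINT s|lebesgue_on {0..T}. norm (b s)) * exp (exp 1 * (LINT s|lebesgue_on {0..t}. g s))"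
    by (intro mult_left_mono) (auto simp: nonneg)
  finally show ?case by simp
next
  case (Suc n t)
  define H where "H t = (LINT s|lebesgue_on {0..t}. g s)" for t
  define B where "B = (LINT s|lebesgue_on {0..T}. norm (b s))"
  let ?L = "lebesgue_on {0..t}" and ?P = "picard b \<gamma> n x"
  note P = continuous_on_picard[OF b \<gamma>, of n x]
  note int_P = L1_C0_integral_along_curve(2)[OF b P \<open>t \<in> {0..T}\<close>]
  note int_y = L1_C0_integral_along_curve(2)[OF b y \<open>t \<in> {0..T}\<close>]
  have "0 \<le> B" by (simp add: B_def)
  have "0 \<le> H t" by (simp add: H_def nonneg)
  have int_g: "integrable ?L g"
    using Suc.prems by (intro integrable_subinterval[OF g]) auto
  have [measurable]: "H \<in> borel_measurable ?L"
    unfolding H_def using Suc.prems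
    by (intro continuous_imp_measurable_on_sets_lebesgue indefinite_integral_continuous_real int_g) auto
  have [measurable]: "g \<in> borel_measurable ?L"
    using int_g by auto
  have lip_t: "AE s in ?L. \<forall>z. norm (b s z - b s (y s)) \<le> g s * norm (z - y s)"
    using lip Suc.prems by (auto simp: AE_restrict_space_iff elim!: eventually_mono)
  have "norm (picard b \<gamma> (Suc n) x t - y t) = norm (LINT s|?L. b s (?P s) - b s (y s))"
    using y_eq[OF Suc.prems] int_P int_y by simp
  also have "ennreal \<dots> \<le> (\<integral>\<^sup>+s. norm (b s (?P s) - b s (y s)) \<partial>?L)"
    by (rule integral_norm_bound_ennreal) (intro Bochner_Integration.integrable_diff int_P int_y)
  also have "\<dots> \<le> (\<integral>\<^sup>+s. ennreal (B * exp (- real n)) * (ennreal (g s) * ennreal (exp (exp 1 * H s))) \<partial>?L)"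
  proof (rule nn_integral_mono_AE)
    have "AE s in ?L. s \<in> {0..t}"
      using AE_space[of ?L] by simp
    with lip_t show "AE s in ?L. ennreal (norm (b s (?P s) - b s (y s)))
        \<le> ennreal (B * exp (- real n)) * (ennreal (g s) * ennreal (exp (exp 1 * H s)))"
    proof eventually_elim
      case (elim s)
      have "norm (b s (?P s) - b s (y s)) \<le> g s * norm (?P s - y s)"
        using elim by blast
      also have "\<dots> \<le> g s * (B * exp (- real n) * exp (exp 1 * H s))"
        unfolding B_def H_def using elim Suc.prems by (intro mult_left_mono Suc.IH nonneg) auto
      finally show ?case
        using nonneg[of s] \<open>0 \<le> B\<close> by (simp add: ennreal_mult'[symmetric] ennreal_leI mult_ac)
    qed
  qed
  also have "\<dots> = ennreal (B * exp (- real n)) * (\<integral>\<^sup>+s. ennreal (g s) * ennreal (exp (exp 1 * H s)) \<partial>?L)"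
    by (intro nn_integral_cmult) measurable
  also have "\<dots> = ennreal (B * exp (- real n)) * ennreal ((exp (exp 1 * H t) - 1) / exp 1)"
    unfolding H_def by (subst nn_integral_exp_primitive[OF g nonneg Suc.prems]) auto
  also have "\<dots> = ennreal (B * exp (- real n) * ((exp (exp 1 * H t) - 1) / exp 1))"
    using \<open>0 \<le> H t\<close> \<open>0 \<le> B\<close> by (subst ennreal_mult) auto
  finally have "norm (picard b \<gamma> (Suc n) x t - y t) \<le> B * exp (- real n) * ((exp (exp 1 * H t) - 1) / exp 1)"
    using \<open>0 \<le> H t\<close> \<open>0 \<le> B\<close> by (subst (asm) ennreal_le_iff) auto
  \<comment> \<open>The discarded \<open>- 1\<close> is the contribution of the lower endpoint,
    where \<open>H\<close> vanishes.\<close>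
  also have "\<dots> \<le> B * exp (- real n) * (exp (exp 1 * H t) / exp 1)"
    using \<open>0 \<le> B\<close> by (intro mult_left_mono divide_right_mono) auto
  also have "\<dots> = B * exp (- real (Suc n)) * exp (exp 1 * H t)"
    by (simp add: exp_diff exp_minus field_simps exp_add)
  finally show ?case
    by (simp add: B_def H_def)
qed

text \<open>Passage to weights with values in \<open>[0, \<infinity>]\<close>, in three cases: no
  drift; positive drift and infinite weight integral, where the right-hand side is infinite; finite
  weight integral, where the weight can be made real.\<close>

lemma picard_weighted_error_bound:
  fixes b :: "real \<Rightarrow> (real^'n) \<Rightarrow>\<^sub>C (real^'n)"
  assumes b: "L1_C0 T b" and \<gamma>: "continuous_on {0..T} \<gamma>"
    and y: "continuous_on {0..T} y"
    and y_eq: "\<And>t. t \<in> {0..T} \<Longrightarrow> y t = x + (LINT s|lebesgue_on {0..t}. b s (y s)) + \<gamma> t"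
    and g[measurable]: "g \<in> borel_measurable (lebesgue_on {0..T})"
    and lip: "AE s in lebesgue_on {0..T}. \<forall>z. ennreal (norm (b s z - b s (y s))) \<le> g s * ennreal (norm (z - y s))"
    and t: "t \<in> {0..T}"
  shows "ennreal (exp (real n)) * ennreal (norm (picard b \<gamma> n x t - y t))
    \<le> ennreal_exp (ennreal (exp 1) * (\<integral>\<^sup>+s. g s \<partial>lebesgue_on {0..T}))
        * ennreal (LINT s|lebesgue_on {0..T}. norm (b s))"
proof -
  define B where "B = (LINT s|lebesgue_on {0..T}. norm (b s))"
  have "0 \<le> B" by (simp add: B_def)
  define W where "W = (\<integral>\<^sup>+s. g s \<partial>lebesgue_on {0..T})"
  \<comment> \<open>The right-hand side is 0 even for \<open>W = top\<close>, since
    \<open>top * 0 = 0\<close>. So the iterates must coincide with \<open>y\<close>, which holds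
    because every drift integral vanishes.\<close>
  have ?thesis if "B = 0"
  proof -
    have zero: "(LINT s|lebesgue_on {0..t}. b s (z s)) = 0" if "continuous_on {0..T} z" for z
      using L1_C0_integral_along_curve(3)[OF b that t] \<open>B = 0\<close> by (simp add: B_def)
    have "picard b \<gamma> n x t = y t"
      using y_eq[OF t] zero[OF y] zero[OF continuous_on_picard[OF b \<gamma>]] by (cases n) auto
    then show ?thesis by simp
  qed
  moreover have ?thesis if "B > 0" "W = top"
    using that by (simp add: ennreal_exp_def W_def[symmetric] B_def[symmetric] ennreal_mult_top ennreal_top_mult)
  moreover have ?thesis if "W < top"
  proof -
    \<comment> \<open>\<open>enn2real\<close> sends infinity to 0; as the integral is finite, this
      alters \<open>g\<close> on a null set only.\<close>
    define G where "G s = enn2real (g s)" for s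
    have fin: "AE s in lebesgue_on {0..T}. g s \<noteq> \<infinity>"
      using that by (intro nn_integral_noteq_infinite g) (simp add: W_def)
    then have G_eq: "AE s in lebesgue_on {0..T}. g s = ennreal (G s)"
      by eventually_elim (simp add: G_def less_top)
    have W_eq: "W = (\<integral>\<^sup>+s. ennreal (G s) \<partial>lebesgue_on {0..T})"
      unfolding W_def by (rule nn_integral_cong_AE[OF G_eq])
    have G_nonneg: "0 \<le> G s" for s by (simp add: G_def)
    have G_int: "integrable (lebesgue_on {0..T}) G"
    proof (rule integrableI_nonneg)
      show "G \<in> borel_measurable (lebesgue_on {0..T})"
        unfolding G_def by measurable
    qed (use that W_eq G_nonneg in auto)
    have G_lip: "AE s in lebesgue_on {0..T}. \<forall>z. norm (b s z - b s (y s)) \<le> G s * norm (z - y s)"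
      using lip G_eq by eventually_elim (simp add: ennreal_mult'[symmetric] ennreal_le_iff G_nonneg)
    have W_int: "W = ennreal (LINT s|lebesgue_on {0..T}. G s)"
      unfolding W_eq using G_int G_nonneg by (intro nn_integral_eq_integral) auto
    have "ennreal (LINT s|lebesgue_on {0..t}. G s) = (\<integral>\<^sup>+s. ennreal (G s) \<partial>lebesgue_on {0..t})"
      using t G_nonneg by (intro nn_integral_eq_integral[symmetric] integrable_subinterval[OF G_int]) auto
    also have "\<dots> \<le> W"
      unfolding W_eq using t by (auto simp: nn_integral_restrict_space indicator_def intro!: nn_integral_mono)
    finally have mono: "(LINT s|lebesgue_on {0..t}. G s) \<le> (LINT s|lebesgue_on {0..T}. G s)"
      by (simp add: W_int ennreal_le_iff G_nonneg)
    have "exp (real n) * norm (picard b \<gamma> n x t - y t)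
        \<le> exp (real n) * (B * exp (- real n) * exp (exp 1 * (LINT s|lebesgue_on {0..t}. G s)))"
      unfolding B_def by (intro mult_left_mono picard_error_bound b \<gamma> y y_eq G_int G_nonneg G_lip t) auto
    also have "\<dots> = B * exp (exp 1 * (LINT s|lebesgue_on {0..t}. G s))"
      by (simp add: exp_minus)
    also have "\<dots> \<le> B * exp (exp 1 * (LINT s|lebesgue_on {0..T}. G s))"
      using mono \<open>0 \<le> B\<close> by (intro mult_left_mono) auto
    finally have "ennreal (exp (real n) * norm (picard b \<gamma> n x t - y t))
        \<le> ennreal (B * exp (exp 1 * (LINT s|lebesgue_on {0..T}. G s)))"
      by (rule ennreal_leI)
    also have "\<dots> = ennreal_exp (ennreal (exp 1) * W) * ennreal B"
      using \<open>0 \<le> B\<close> G_nonneg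
      by (simp add: W_int ennreal_exp_def ennreal_mult[symmetric] ennreal_mult_eq_top_iff mult.commute)
    finally show ?thesis
      by (simp add: ennreal_mult' W_def B_def)
  qed
  ultimately show ?thesis
    using \<open>0 \<le> B\<close> less_top by fastforce
qed

theorem theorem2p13:
  fixes T C :: real
    and \<gamma> :: "real \<Rightarrow> real^'n"
    and b :: "real \<Rightarrow> (real^'n) \<Rightarrow>\<^sub>C (real^'n)"
    and G :: "real \<Rightarrow> real^'n \<Rightarrow> real^'n^'n"
    and X :: "real \<Rightarrow> real^'n \<Rightarrow> real^'n"
    and h :: "real \<Rightarrow> real^'n \<Rightarrow> ennreal"
  assumes "CARD('n) \<ge> 2"
    and "T > 0"
    and "continuous_on {0..T} \<gamma>"
    and "L1_C0 T b"
    and "AE t\<in>{0..T} in lebesgue. divergence_free (b t)"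
    and "AE t\<in>{0..T} in lebesgue. weak_gradient (b t) (G t)"
    and "L1_lorentz T (real CARD('n)) 1 G"
    and "regular_lagrangian_flow T b \<gamma> X"
    and "lusin_lipschitz_weight T C b G h"
  shows "AE x in lebesgue.
    (SUP n. ennreal (exp (real n)) * CT_norm T (\<lambda>t. picard b \<gamma> n x t - X t x))
      \<le> ennreal_exp (ennreal (exp 1) * weight_along_flow T h X x)
          * ennreal (LINT t|lebesgue_on {0..T}. norm (b t))"
proof -
  note \<gamma> = \<open>continuous_on {0..T} \<gamma>\<close> and b = \<open>L1_C0 T b\<close>
  have flow: "AE x in lebesgue.
        abs_continuous_on 0 T (\<lambda>t. X t x - \<gamma> t) \<and>
        X 0 x - \<gamma> 0 = x \<and>
        (AE t\<in>{0..T} in lebesgue.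
           ((\<lambda>t. X t x - \<gamma> t) has_vector_derivative b t (X t x)) (at t within {0..T}))"
    and X_meas: "\<And>t. t \<in> {0..T} \<Longrightarrow> X t \<in> borel_measurable lebesgue"
    using \<open>regular_lagrangian_flow T b \<gamma> X\<close>
    unfolding regular_lagrangian_flow_def by (auto elim: eventually_mono)
  obtain L where L: "\<And>t A. \<lbrakk>t \<in> {0..T}; A \<in> sets borel\<rbrakk> \<Longrightarrow> emeasure lebesgue (X t -` A) \<le> ennreal L * emeasure lebesgue A"
    using \<open>regular_lagrangian_flow T b \<gamma> X\<close> unfolding regular_lagrangian_flow_def by blast
  have X_cont: "continuous_on {0..T} (\<lambda>t. X t x)" if "abs_continuous_on 0 T (\<lambda>t. X t x - \<gamma> t)" for x
    using continuous_on_add[OF abs_continuous_on_imp_continuous_on[OF that] \<gamma>] by simp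
  have h: "(\<lambda>(t, x). h t x) \<in> borel_measurable (lebesgue_on ({0..T} \<times> UNIV))"
    and lip: "AE t\<in>{0..T} in lebesgue. \<forall>x y. ennreal (norm (b t x - b t y)) \<le> h t x * ennreal (norm (x - y))"
    using \<open>lusin_lipschitz_weight T C b G h\<close>
    by (auto simp: lusin_lipschitz_weight_def L1_weak_lorentz_def jointly_measurable_def elim: eventually_mono)
  have "AE x in lebesgue. (\<lambda>s. case (s, X s x) of (t, x) \<Rightarrow> h t x) \<in> borel_measurable (lebesgue_on {0..T})"
  proof (rule AE_measurable_along_flow[OF _ h X_meas])
    show "AE x in lebesgue. continuous_on {0..T} (\<lambda>t. X t x)"
      using flow by eventually_elim (use X_cont in blast)
    \<comment> \<open>The compression bound gives \<open>L * 0\<close> on a null set; the preimage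
      is measurable because \<open>A\<close> is Borel.\<close>
    show "X t -` A \<in> null_sets lebesgue" if "t \<in> {0..T}" "A \<in> null_sets lborel" for t A
    proof -
      have "X t -` A \<in> sets lebesgue"
        using measurable_sets[OF X_meas[OF that(1)], of A] that(2) by (simp add: null_sets_def)
      moreover have "emeasure lebesgue (X t -` A) = 0"
        using L[OF that(1), of A] that(2) by (simp add: null_sets_def emeasure_completion)
      ultimately show ?thesis by auto
    qed
  qed (use \<open>T > 0\<close> in auto)
  with flow show ?thesis
  proof eventually_elim
    case (elim x)
    then have ac: "abs_continuous_on 0 T (\<lambda>t. X t x - \<gamma> t)" and X0: "X 0 x - \<gamma> 0 = x"
      and deriv: "AE t\<in>{0..T} in lebesgue.
           ((\<lambda>t. X t x - \<gamma> t) has_vector_derivative b t (X t x)) (at t within {0..T})"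
      and h_meas: "(\<lambda>s. h s (X s x)) \<in> borel_measurable (lebesgue_on {0..T})"
      by auto
    \<comment> \<open>Absolute continuity upgrades the almost-everywhere derivative to the integral
      equation. The resulting gauge integral is the Lebesgue integral, as \<open>b\<close> is
      integrable along the trajectory.\<close>
    have X_eq: "X t x = x + (LINT s|lebesgue_on {0..t}. b s (X s x)) + \<gamma> t" if t: "t \<in> {0..T}" for t
    proof -
      have "((\<lambda>s. b s (X s x)) has_integral (X t x - \<gamma> t) - (X 0 x - \<gamma> 0)) {0..t}"
      proof (rule abs_continuous_on_has_integral)
        show "abs_continuous_on 0 t (\<lambda>t. X t x - \<gamma> t)"
          using abs_continuous_on_subinterval[OF ac] t by auto
        show "AE s\<in>{0..t} in lebesgue.
           ((\<lambda>t. X t x - \<gamma> t) has_vector_derivative b s (X s x)) (at s within {0..t})"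
          using deriv by eventually_elim (use t in \<open>auto intro: has_vector_derivative_within_subset\<close>)
      qed (use t in auto)
      moreover have "(LINT s|lebesgue_on {0..t}. b s (X s x)) = integral {0..t} (\<lambda>s. b s (X s x))"
        by (intro lebesgue_integral_eq_integral L1_C0_integral_along_curve(2)[OF b X_cont[OF ac] t]) auto
      ultimately show ?thesis
        using X0 by (simp add: integral_unique algebra_simps)
    qed
    \<comment> \<open>The weight sits at the first argument of the asymmetric bound, so that
      argument is placed on the trajectory and \<open>z\<close> takes the other slot.\<close>
    have X_lip: "AE s in lebesgue_on {0..T}. \<forall>z. ennreal (norm (b s z - b s (X s x))) \<le> h s (X s x) * ennreal (norm (z - X s x))"
    proof -
      have "AE s in lebesgue. s \<in> {0..T} \<longrightarrow>
          (\<forall>z. ennreal (norm (b s z - b s (X s x))) \<le> h s (X s x) * ennreal (norm (z - X s x)))"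
        using lip by eventually_elim (metis norm_minus_commute)
      then show ?thesis
        by (simp add: AE_restrict_space_iff)
    qed
    \<comment> \<open>The bound involves neither \<open>t\<close> nor \<open>n\<close>, so it passes
      to both suprema.\<close>
    from picard_weighted_error_bound[OF b \<gamma> X_cont[OF ac] X_eq h_meas X_lip]
    show ?case
      by (auto simp: CT_norm_def weight_along_flow_def nn_integral_restrict_space SUP_mult_left_ennreal intro!: SUP_least)
  qed
qed

end
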